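(* Let $q=\langle H,f,f^-,c,c^-\rangle$ be a consistent $q$-dialectical system with connectives and let $\alpha$ be a computable approximation to $H$ such that $(q,\alpha)$ is loopless. Then $A_q^\alpha$ is a completion.
   Context: An enumeration operator is a c.e. set $H$ of (codes of) pairs $\langle x,D\rangle$, $x\in\omega$, $D\subseteq\omega$ finite; $H(X)=\{x:\exists D\subseteq X\ \langle x,D\rangle\in H\}$. $H$ is an algebraic closure operator if $X\subseteq H(X)$ and $H(H(X))\subseteq H(X)$ for all $X$. A computable approximation $\alpha=\{H_s\}$ to $H$ is a computable increasing sequence of finite sets of pairs with union $H$. A $q$-dialectical system is $q=\langle H,f,f^-,c,c^-\rangle$ with $H$ an enumeration operator that is an algebraic closure operator, $H(\emptyset)\ne\emptyset$, $H(\{c\})=\omega$; $f$ a computable permutation of $\omega$ ($f_i=f(i)$); $f^-$ computable and acyclic (every $f^-$-orbit infinite); $c\in\omega$; $c^-\in\omega\setminus\mathrm{range}(f^-)$. It is consistent if $\{c,c^-\}\cap H(\emptyset)=\emptyset$. $q$-dialectical procedure relative to $\alpha$: stacks $r_s(x)$, $m(s)$, finite sets $A_s$; $\rho_s(x)$ = top of $r_s(x)$ when nonempty, $L_s(x)=\{\rho_s(y):y<x,\ r_s(y)\ne\langle\,\rangle\}$, $\chi_s(i)=H_s(L_s(i+1))$. Stage 0: $m(0)=0$, $r_0(0)=\langle f_0\rangle$, others empty, $A_0=\emptyset$. Stage $s+1$, $m=m(s)$: (1) if no $k\le m$ has $\{c,c^-\}\cap\chi_s(k)\ne\emptyset$: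 $m(s+1)=m+1$, stacks at $x\le m$ unchanged, $r_{s+1}(m+1)=\langle f_{m+1}\rangle$, above empty; (2) if some $k\le m$ has $c\in\chi_s(k)$ and $c^-\notin\chi_s(k')$ for all $k'<k$, let $z$ be least such: if $c\in H_s(\emptyset)$ then $m(s+1)=0$, $r_{s+1}(0)=\langle f_0\rangle$, others empty; otherwise $m(s+1)=z+1$, stacks at $x<z$ unchanged, $r_{s+1}(z+1)=\langle f_{z+1}\rangle$, $r_{s+1}(x)=\langle\,\rangle$ for $x=z$ and $x>z+1$; (3) if some $k\le m$ has $c^-\in\chi_s(k)$ and $c\notin\chi_s(k')$ for all $k'\le k$, let $z$ be least such: $m(s+1)=z$, stacks at $x<z$ unchanged, $r_{s+1}(z)=r_s(z)^\frown\langle f^-(\rho_s(z))\rangle$, stacks at $x>z$ empty. $A_{s+1}=\bigcup_{i<m(s+1)}\chi_{s+1}(i)$. $A_q^\alpha=\{f_x:\exists t\,\forall s\ge t\ f_x\in A_s\}$. $(q,\alpha)$ is loopless if for every $u$ the set $\{\rho_s(u):s\in\omega\}$ is finite. The system has connectives if there are injective computable functions $\neg,\to,\wedge,\vee$ on $\omega$ such that for all $X\subseteq\omega$, $x,y\in\omega$: (1) $c\in H(\{x,\neg x\})$; (2) $H(\{\neg\neg x\})=H(\{x\})$; (3) $x\vee\neg x\in H(\emptyset)$; (4) $H(X\cup\{x\vee y\})=H(X\cup\{x\})\cap H(X\cup\{y\})$; (5) if $c\in H(X\cup\{x\})$ then $\neg x\in H(X)$; (6) $x\in H(X\cup\{y\})$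 iff $y\to x\in H(X)$. A set $A$ is a completion if for every $x$, $A\cap\{x,\neg x\}$ has exactly one element. *)

theory Defs
  imports Main "HOL-Library.Nat_Bijection"
begin

section \<open>Computability\<close>

text \<open>
  Programs for the partial recursive functions. The judgement \<open>evaluates p xs y\<close> says that program
  \<open>p\<close> halts on the arguments \<open>xs\<close> with value \<open>y\<close>. In \<open>PrimRec\<close> and \<open>Mu\<close> the recursion
  (respectively search) variable is the first argument.
\<close>

datatype program =
    Zero
  | Succ
  | Proj nat
  | Comp program "program list"
  | PrimRec program program
  | Mu program

inductive evaluates :: "program \<Rightarrow> nat list \<Rightarrow> nat \<Rightarrow> bool" where
  zero: "evaluates Zero xs 0"
| succ: "evaluates Succ [x] (Suc x)"
| proj: "i < length xs \<Longrightarrow> evaluates (Proj i) xs (xs ! i)"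
| comp: "list_all2 (\<lambda>g y. evaluates g xs y) gs ys \<Longrightarrow> evaluates p ys v
    \<Longrightarrow> evaluates (Comp p gs) xs v"
| prim_0: "evaluates p xs v \<Longrightarrow> evaluates (PrimRec p g) (0 # xs) v"
| prim_Suc: "evaluates (PrimRec p g) (n # xs) u \<Longrightarrow> evaluates g (n # u # xs) v
    \<Longrightarrow> evaluates (PrimRec p g) (Suc n # xs) v"
| mu: "evaluates p (n # xs) 0 \<Longrightarrow> (\<forall>i<n. \<exists>v>0. evaluates p (i # xs) v)
    \<Longrightarrow> evaluates (Mu p) xs n"

lemma evaluates_deterministic:
  "evaluates p xs v \<Longrightarrow> evaluates p xs w \<Longrightarrow> v = w"
proof (induction p xs v arbitrary: w rule: evaluates.induct)
  case (zero xs)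
  then show ?case by (auto elim: evaluates.cases)
next
  case (succ x)
  then show ?case by (auto elim: evaluates.cases)
next
  case (proj i xs)
  then show ?case by (auto elim: evaluates.cases)
next
  case (comp xs gs ys p v)
  from comp.prems obtain zs
    where zs: "list_all2 (\<lambda>g y. evaluates g xs y) gs zs" and w: "evaluates p zs w"
    by (auto elim: evaluates.cases)
  have "ys = zs"
    using comp.IH(1) zs by (intro nth_equalityI) (auto simp: list_all2_conv_all_nth)
  then show ?case using comp.IH(2) w by simp
next
  case (prim_0 p xs v g)
  from prim_0.prems have "evaluates p xs w" by (auto elim: evaluates.cases)
  then show ?case by (rule prim_0.IH)
next
  case (prim_Suc p g n xs u v)
  from prim_Suc.prems obtain u'
    where "evaluates (PrimRec p g) (n # xs) u'" and "evaluates g (n # u' # xs) w"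
    by (auto elim: evaluates.cases)
  then show ?case using prim_Suc.IH by blast
next
  case (mu p n xs)
  from mu.prems have w: "evaluates p (w # xs) 0" "\<forall>i<w. \<exists>v>0. evaluates p (i # xs) v"
    by (auto elim: evaluates.cases)
  show ?case
    using mu.IH w by (metis less_irrefl linorder_neqE_nat)
qed

definition computable :: "(nat \<Rightarrow> nat) \<Rightarrow> bool" where
  "computable g \<longleftrightarrow> (\<exists>p. \<forall>x. evaluates p [x] (g x))"

definition computable2 :: "(nat \<Rightarrow> nat \<Rightarrow> nat) \<Rightarrow> bool" where
  "computable2 g \<longleftrightarrow> (\<exists>p. \<forall>x y. evaluates p [x, y] (g x y))"

definition ce_set :: "nat set \<Rightarrow> bool" where
  "ce_set W \<longleftrightarrow> (\<exists>p. \<forall>x. x \<in> W \<longleftrightarrow> (\<exists>y. evaluates p [x] y))"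


section \<open>Enumeration operators\<close>

text \<open>
  An operator is kept as a set of actual pairs \<open>(x, D)\<close>; codes enter only where computability is
  asserted.
\<close>

definition pair_code :: "nat \<times> nat set \<Rightarrow> nat" where
  "pair_code = (\<lambda>(x, D). prod_encode (x, set_encode D))"

definition enumeration_operator :: "(nat \<times> nat set) set \<Rightarrow> bool" where
  "enumeration_operator H \<longleftrightarrow> (\<forall>(x, D) \<in> H. finite D) \<and> ce_set (pair_code ` H)"

definition app :: "(nat \<times> nat set) set \<Rightarrow> nat set \<Rightarrow> nat set" where
  "app H X = {x. \<exists>D. finite D \<and> D \<subseteq> X \<and> (x, D) \<in> H}"

definition algebraic_closure_operator :: "(nat \<times> nat set) set \<Rightarrow> bool" where
  "algebraic_closure_operator H \<longleftrightarrow> (\<forall>X. X \<subseteq> app H X \<and> app H (app H X) \<subseteq> app H X)"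

text \<open>
  Computability of a sequence of finite sets means that the canonical index of the stage-\<open>s\<close> set is
  a computable function of \<open>s\<close>.
\<close>

definition computable_approximation ::
    "(nat \<times> nat set) set \<Rightarrow> (nat \<Rightarrow> (nat \<times> nat set) set) \<Rightarrow> bool" where
  "computable_approximation H \<alpha> \<longleftrightarrow>
     (\<forall>s. finite (\<alpha> s)) \<and>
     (\<forall>s. \<alpha> s \<subseteq> \<alpha> (Suc s)) \<and>
     (\<Union>s. \<alpha> s) = H \<and>
     computable (\<lambda>s. set_encode (pair_code ` \<alpha> s))"


section \<open>q-dialectical systems\<close>

text \<open>The fields are \<open>H\<close>, \<open>f\<close>, \<open>f\<^sup>-\<close>, \<open>c\<close>, \<open>c\<^sup>-\<close> in this order.\<close>

record q_system =
  oper :: "(nat \<times> nat set) set"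
  perm :: "nat \<Rightarrow> nat"
  revise :: "nat \<Rightarrow> nat"
  contra :: nat
  counter :: nat

definition q_dialectical_system :: "q_system \<Rightarrow> bool" where
  "q_dialectical_system q \<longleftrightarrow>
     enumeration_operator (oper q) \<and>
     algebraic_closure_operator (oper q) \<and>
     app (oper q) {} \<noteq> {} \<and>
     app (oper q) {contra q} = UNIV \<and>
     computable (perm q) \<and> bij (perm q) \<and>
     computable (revise q) \<and> (\<forall>x. infinite (range (\<lambda>n. (revise q ^^ n) x))) \<and>
     counter q \<notin> range (revise q)"

definition consistent :: "q_system \<Rightarrow> bool" where
  "consistent q \<longleftrightarrow> {contra q, counter q} \<inter> app (oper q) {} = {}"


section \<open>The q-dialectical procedure\<close>

text \<open>Stacks are lists whose top is the last element.\<close>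

definition L_set :: "(nat \<Rightarrow> nat list) \<Rightarrow> nat \<Rightarrow> nat set" where
  "L_set r x = {last (r y) | y. y < x \<and> r y \<noteq> []}"

definition chi :: "(nat \<times> nat set) set \<Rightarrow> (nat \<Rightarrow> nat list) \<Rightarrow> nat \<Rightarrow> nat set" where
  "chi Hs r i = app Hs (L_set r (i + 1))"

definition no_alarm_at :: "q_system \<Rightarrow> (nat \<times> nat set) set \<Rightarrow> (nat \<Rightarrow> nat list) \<Rightarrow> nat \<Rightarrow> bool" where
  "no_alarm_at q Hs r k \<longleftrightarrow> {contra q, counter q} \<inter> chi Hs r k = {}"

definition contra_at :: "q_system \<Rightarrow> (nat \<times> nat set) set \<Rightarrow> (nat \<Rightarrow> nat list) \<Rightarrow> nat \<Rightarrow> bool" where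
  "contra_at q Hs r k \<longleftrightarrow>
     contra q \<in> chi Hs r k \<and> (\<forall>k'<k. counter q \<notin> chi Hs r k')"

definition counter_at :: "q_system \<Rightarrow> (nat \<times> nat set) set \<Rightarrow> (nat \<Rightarrow> nat list) \<Rightarrow> nat \<Rightarrow> bool" where
  "counter_at q Hs r k \<longleftrightarrow>
     counter q \<in> chi Hs r k \<and> (\<forall>k'\<le>k. contra q \<notin> chi Hs r k')"

lemma chi_mono: "i \<le> j \<Longrightarrow> chi Hs r i \<subseteq> chi Hs r j"
  unfolding chi_def app_def L_set_def by fastforce

text \<open>Exactly one of the three clauses of the procedure applies at every stage.\<close>

lemma clauses_exhaustive:
  "(\<forall>k\<le>m. no_alarm_at q Hs r k) \<or> (\<exists>k\<le>m. contra_at q Hs r k) \<or> (\<exists>k\<le>m. counter_at q Hs r k)"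
proof (cases "\<forall>k\<le>m. no_alarm_at q Hs r k")
  case False
  define k where "k = (LEAST k. \<not> no_alarm_at q Hs r k)"
  have k: "\<not> no_alarm_at q Hs r k" "k \<le> m"
    using False unfolding k_def by (metis LeastI, metis Least_le order_trans)
  have below: "no_alarm_at q Hs r k'" if "k' < k" for k'
    using that not_less_Least unfolding k_def by blast
  have "contra_at q Hs r k \<or> counter_at q Hs r k"
    using k(1) below unfolding no_alarm_at_def contra_at_def counter_at_def
    by (auto simp: le_less)
  then show ?thesis using k(2) by blast
qed simp

lemma clauses_exclusive:
  assumes "contra_at q Hs r k" and "counter_at q Hs r l"
  shows False
proof -
  have "\<not> l < k" using assms unfolding contra_at_def counter_at_def by auto
  moreover have "\<not> k \<le> l" using assms unfolding contra_at_def counter_at_def by auto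
  ultimately show False by simp
qed

text \<open>
  One stage, with current bound \<open>m\<close>, stacks \<open>r\<close> and approximation \<open>Hs\<close>. In the last clause
  \<open>r z = []\<close> would require \<open>z = 0\<close> and \<open>c\<^sup>- \<in> app Hs {}\<close>, which a consistent system excludes, so
  \<open>last (r z)\<close> is always the top of a nonempty stack there.
\<close>

definition start_stacks :: "q_system \<Rightarrow> nat \<Rightarrow> nat list" where
  "start_stacks q = (\<lambda>x. if x = 0 then [perm q 0] else [])"

definition step :: "q_system \<Rightarrow> (nat \<times> nat set) set \<Rightarrow> nat \<times> (nat \<Rightarrow> nat list)
    \<Rightarrow> nat \<times> (nat \<Rightarrow> nat list)" where
  "step q Hs = (\<lambda>(m, r).
     if \<forall>k\<le>m. no_alarm_at q Hs r k then
       (m + 1, \<lambda>x. if x \<le> m then r x else if x = m + 1 then [perm q (m + 1)] else [])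
     else if \<exists>k\<le>m. contra_at q Hs r k then
       (let z = (LEAST k. k \<le> m \<and> contra_at q Hs r k) in
        if contra q \<in> app Hs {} then (0, start_stacks q)
        else (z + 1, \<lambda>x. if x < z then r x else if x = z + 1 then [perm q (z + 1)] else []))
     else
       (let z = (LEAST k. k \<le> m \<and> counter_at q Hs r k) in
        (z, \<lambda>x. if x < z then r x
                else if x = z then r z @ [revise q (last (r z))] else [])))"

primrec proc :: "q_system \<Rightarrow> (nat \<Rightarrow> (nat \<times> nat set) set) \<Rightarrow> nat \<Rightarrow> nat \<times> (nat \<Rightarrow> nat list)" where
  "proc q \<alpha> 0 = (0, start_stacks q)"
| "proc q \<alpha> (Suc s) = step q (\<alpha> s) (proc q \<alpha> s)"

definition m_at :: "q_system \<Rightarrow> (nat \<Rightarrow> (nat \<times> nat set) set) \<Rightarrow> nat \<Rightarrow> nat" where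
  "m_at q \<alpha> s = fst (proc q \<alpha> s)"

definition r_at :: "q_system \<Rightarrow> (nat \<Rightarrow> (nat \<times> nat set) set) \<Rightarrow> nat \<Rightarrow> nat \<Rightarrow> nat list" where
  "r_at q \<alpha> s = snd (proc q \<alpha> s)"

text \<open>For \<open>s = 0\<close> the union is empty because \<open>m_at q \<alpha> 0 = 0\<close>.\<close>

definition A_at :: "q_system \<Rightarrow> (nat \<Rightarrow> (nat \<times> nat set) set) \<Rightarrow> nat \<Rightarrow> nat set" where
  "A_at q \<alpha> s = (\<Union>i<m_at q \<alpha> s. chi (\<alpha> s) (r_at q \<alpha> s) i)"

definition final_set :: "q_system \<Rightarrow> (nat \<Rightarrow> (nat \<times> nat set) set) \<Rightarrow> nat set" where
  "final_set q \<alpha> = {perm q x | x. \<exists>t. \<forall>s\<ge>t. perm q x \<in> A_at q \<alpha> s}"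

definition loopless :: "q_system \<Rightarrow> (nat \<Rightarrow> (nat \<times> nat set) set) \<Rightarrow> bool" where
  "loopless q \<alpha> \<longleftrightarrow> (\<forall>u. finite {last (r_at q \<alpha> s u) | s. r_at q \<alpha> s u \<noteq> []})"


section \<open>Connectives and completions\<close>

text \<open>
  Injectivity of the binary connectives is injectivity on pairs. As in the source, no law relates
  conjunction to the operator.
\<close>

definition connectives :: "q_system \<Rightarrow> (nat \<Rightarrow> nat) \<Rightarrow> (nat \<Rightarrow> nat \<Rightarrow> nat) \<Rightarrow>
    (nat \<Rightarrow> nat \<Rightarrow> nat) \<Rightarrow> (nat \<Rightarrow> nat \<Rightarrow> nat) \<Rightarrow> bool" where
  "connectives q neg imp con dis \<longleftrightarrow>
     computable neg \<and> inj neg \<and>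
     computable2 imp \<and> inj (\<lambda>(x, y). imp x y) \<and>
     computable2 con \<and> inj (\<lambda>(x, y). con x y) \<and>
     computable2 dis \<and> inj (\<lambda>(x, y). dis x y) \<and>
     (let H = app (oper q); c = contra q in
       \<forall>X x y.
         c \<in> H {x, neg x} \<and>
         H {neg (neg x)} = H {x} \<and>
         dis x (neg x) \<in> H {} \<and>
         H (X \<union> {dis x y}) = H (X \<union> {x}) \<inter> H (X \<union> {y}) \<and>
         (c \<in> H (X \<union> {x}) \<longrightarrow> neg x \<in> H X) \<and>
         (x \<in> H (X \<union> {y}) \<longleftrightarrow> imp y x \<in> H X))"

definition completion :: "(nat \<Rightarrow> nat) \<Rightarrow> nat set \<Rightarrow> bool" where
  "completion neg A \<longleftrightarrow> (\<forall>x. \<exists>!y. y \<in> A \<inter> {x, neg x})"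

end

theory Submission
  imports Defs
begin

text \<open>
  Looplessness makes every stack converge, and the final set is the closure of the set \<open>L\<close> of tops of
  the limit stacks; it contains neither \<open>c\<close> nor \<open>c\<^sup>-\<close>, since each would raise an alarm forever. An
  axiom \<open>x\<close> missing from \<open>L\<close> was discarded or replaced because, over \<open>L\<close>, it yields \<open>c\<close> or \<open>c\<^sup>-\<close>.
  If neither \<open>x\<close> nor \<open>\<not> x\<close> is in the closure, \<open>c\<close> is impossible for both by negation introduction, so
  both yield \<open>c\<^sup>-\<close> over \<open>L\<close>; by \<open>x \<or> \<not> x\<close> and proof by cases \<open>L\<close> itself yields \<open>c\<^sup>-\<close>, a
  contradiction.
\<close>

section \<open>Enumeration operators and sets of stack tops\<close>

lemma app_mono: "G \<subseteq> H \<Longrightarrow> X \<subseteq> Y \<Longrightarrow> app G X \<subseteq> app H Y"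
  unfolding app_def by blast

lemma L_set_Suc:
  "L_set r (Suc u) = (if r u = [] then L_set r u else insert (last (r u)) (L_set r u))"
  unfolding L_set_def by (auto simp: less_Suc_eq)

lemma L_set_0 [simp]: "L_set r 0 = {}"
  unfolding L_set_def by simp

lemma L_set_mono: "u \<le> v \<Longrightarrow> L_set r u \<subseteq> L_set r v"
  unfolding L_set_def by fastforce

lemma L_set_cong: "(\<And>y. y < u \<Longrightarrow> r y = r' y) \<Longrightarrow> L_set r u = L_set r' u"
  unfolding L_set_def by force

lemma finite_subset_L_set:
  assumes "finite D" and "D \<subseteq> (\<Union>u. L_set r u)"
  obtains u where "D \<subseteq> L_set r u"
proof -
  have "\<exists>u. D \<subseteq> L_set r u"
    using assms
  proof (induction D)
    case (insert d D)
    then obtain u v where "D \<subseteq> L_set r u" "d \<in> L_set r v" by auto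
    then have "insert d D \<subseteq> L_set r (max u v)"
      using L_set_mono[of u "max u v" r] L_set_mono[of v "max u v" r] by auto
    then show ?case ..
  qed simp
  then show thesis using that by blast
qed

lemma app_closed:
  assumes "algebraic_closure_operator H" and "Y \<subseteq> app H X"
  shows "app H Y \<subseteq> app H X"
  using assms app_mono[of H H Y "app H X"] unfolding algebraic_closure_operator_def by blast

lemma app_insert_absorb:
  assumes "algebraic_closure_operator H" and "y \<in> app H X"
  shows "app H (insert y X) = app H X"
proof
  show "app H (insert y X) \<subseteq> app H X"
    using assms by (intro app_closed) (auto simp: algebraic_closure_operator_def)
qed (intro app_mono, auto)

section \<open>The effect of a single stage\<close>

lemma alarm_stack_nonempty:
  assumes "\<not> no_alarm_at q Hs r z" and "\<forall>k<z. no_alarm_at q Hs r k"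
    and "{contra q, counter q} \<inter> app Hs {} = {}"
  shows "r z \<noteq> []"
proof
  assume "r z = []"
  \<comment> \<open>An empty stack adds no top, so an alarm at \<open>z\<close> would already sound
    at \<open>z - 1\<close>, or over the empty set when \<open>z = 0\<close>.\<close>
  then have eq: "chi Hs r z = app Hs (L_set r z)"
    unfolding chi_def by (simp add: L_set_Suc)
  show False
  proof (cases z)
    case 0
    then show False using assms(1,3) eq unfolding no_alarm_at_def by simp
  next
    case (Suc k)
    then have "chi Hs r z = chi Hs r k" using eq unfolding chi_def by simp
    then show False using assms(1,2) Suc unfolding no_alarm_at_def by simp
  qed
qed

text \<open>Discarding and revision both act at the least position with any alarm: the least
  position for one kind cannot lie above an alarm of the other kind. Consistency removes the restart
  at 0, and only the stacks up to the new bound are described.\<close>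

lemma step_cases:
  assumes cons: "{contra q, counter q} \<inter> app Hs {} = {}"
    and step: "step q Hs (m, r) = (m', r')"
  obtains
    (advance) "\<forall>k\<le>m. no_alarm_at q Hs r k" "m' = Suc m" "\<forall>x\<le>m. r' x = r x"
      "r' (Suc m) = [perm q (Suc m)]"
  | (discard) z where "z \<le> m" "\<forall>k<z. no_alarm_at q Hs r k" "\<not> no_alarm_at q Hs r z"
      "r z \<noteq> []" "m' = Suc z" "\<forall>x<z. r' x = r x" "r' z = []" "r' (Suc z) = [perm q (Suc z)]"
  | (revision) z where "z \<le> m" "\<forall>k<z. no_alarm_at q Hs r k" "\<not> no_alarm_at q Hs r z"
      "r z \<noteq> []" "m' = z" "\<forall>x<z. r' x = r x" "r' z = r z @ [revise q (last (r z))]"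
proof -
  consider (1) "\<forall>k\<le>m. no_alarm_at q Hs r k"
    | (2) "\<not> (\<forall>k\<le>m. no_alarm_at q Hs r k)" "\<exists>k\<le>m. contra_at q Hs r k"
    | (3) "\<not> (\<forall>k\<le>m. no_alarm_at q Hs r k)" "\<not> (\<exists>k\<le>m. contra_at q Hs r k)"
    by blast
  then show thesis
  proof cases
    case 1
    then show thesis using step by (intro advance) (auto simp: step_def)
  next
    case 2
    define z where "z = (LEAST k. k \<le> m \<and> contra_at q Hs r k)"
    have z: "z \<le> m" "contra_at q Hs r z"
      using LeastI_ex[of "\<lambda>k. k \<le> m \<and> contra_at q Hs r k"] 2(2) unfolding z_def by auto
    have not_contra: "\<not> contra_at q Hs r k" if "k < z" for k
      using not_less_Least[of k "\<lambda>k. k \<le> m \<and> contra_at q Hs r k"] that z(1)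
      unfolding z_def[symmetric] by auto
    have below: "\<forall>k<z. no_alarm_at q Hs r k"
    proof (intro allI impI)
      fix k assume k: "k < z"
      have "counter q \<notin> chi Hs r k'" if "k' \<le> k" for k'
        using z(2) k that unfolding contra_at_def by simp
      then show "no_alarm_at q Hs r k"
        using not_contra[OF k] unfolding no_alarm_at_def contra_at_def by simp
    qed
    have alarm: "\<not> no_alarm_at q Hs r z"
      using z(2) unfolding contra_at_def no_alarm_at_def by simp
    have "contra q \<notin> app Hs {}" using cons by simp
    then have "m' = z + 1"
      "r' = (\<lambda>x. if x < z then r x else if x = z + 1 then [perm q (z + 1)] else [])"
      using step 2 by (auto simp: step_def z_def[symmetric] Let_def)
    then show thesis
      using z(1) below alarm alarm_stack_nonempty[OF alarm below cons]
      by (intro discard[of z]) auto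
  next
    case 3
    have ex: "\<exists>k. k \<le> m \<and> counter_at q Hs r k"
      using clauses_exhaustive[of m q Hs r] 3 by blast
    define z where "z = (LEAST k. k \<le> m \<and> counter_at q Hs r k)"
    have z: "z \<le> m" "counter_at q Hs r z"
      using LeastI_ex[OF ex] unfolding z_def by auto
    have not_counter: "\<not> counter_at q Hs r k" if "k < z" for k
      using not_less_Least[of k "\<lambda>k. k \<le> m \<and> counter_at q Hs r k"] that z(1)
      unfolding z_def[symmetric] by auto
    have below: "\<forall>k<z. no_alarm_at q Hs r k"
    proof (intro allI impI)
      fix k assume k: "k < z"
      have "contra q \<notin> chi Hs r k'" if "k' \<le> k" for k'
        using z(2) k that unfolding counter_at_def by simp
      then show "no_alarm_at q Hs r k"
        using not_counter[OF k] unfolding no_alarm_at_def counter_at_def by simp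
    qed
    have alarm: "\<not> no_alarm_at q Hs r z"
      using z(2) unfolding counter_at_def no_alarm_at_def by simp
    have "m' = z"
      "r' = (\<lambda>x. if x < z then r x else if x = z then r z @ [revise q (last (r z))] else [])"
      using step 3 by (auto simp: step_def z_def[symmetric] Let_def)
    then show thesis
      using z(1) below alarm alarm_stack_nonempty[OF alarm below cons]
      by (intro revision[of z]) auto
  qed
qed

section \<open>Runs of a consistent system\<close>

locale q_run =
  fixes q :: q_system and \<alpha> :: "nat \<Rightarrow> (nat \<times> nat set) set"
  assumes system: "q_dialectical_system q"
    and consistency: "consistent q"
    and approximation: "computable_approximation (oper q) \<alpha>"
begin

abbreviation "H \<equiv> oper q"
abbreviation "m \<equiv> m_at q \<alpha>"
abbreviation "r \<equiv> r_at q \<alpha>"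

lemma closure: "algebraic_closure_operator H"
  using system unfolding q_dialectical_system_def by simp

lemma approx_subset: "\<alpha> s \<subseteq> H"
  using approximation unfolding computable_approximation_def by auto

lemma approx_eventually:
  assumes "p \<in> H"
  shows "eventually (\<lambda>s. p \<in> \<alpha> s) sequentially"
proof -
  obtain t where "p \<in> \<alpha> t"
    using assms approximation unfolding computable_approximation_def by blast
  moreover have "\<alpha> t \<subseteq> \<alpha> s" if "t \<le> s" for s
    using approximation that lift_Suc_mono_le[of \<alpha>]
    unfolding computable_approximation_def by blast
  ultimately show ?thesis unfolding eventually_sequentially by blast
qed

lemma approx_consistent: "{contra q, counter q} \<inter> app (\<alpha> s) {} = {}"
  using consistency app_mono[OF approx_subset[of s] subset_refl[of "{}"]]
  unfolding consistent_def by blast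

lemma stage_cases:
  obtains
    (advance) "\<forall>k\<le>m s. no_alarm_at q (\<alpha> s) (r s) k" "m (Suc s) = Suc (m s)"
      "\<forall>x\<le>m s. r (Suc s) x = r s x" "r (Suc s) (Suc (m s)) = [perm q (Suc (m s))]"
  | (discard) z where "z \<le> m s" "\<forall>k<z. no_alarm_at q (\<alpha> s) (r s) k"
      "\<not> no_alarm_at q (\<alpha> s) (r s) z" "r s z \<noteq> []" "m (Suc s) = Suc z"
      "\<forall>x<z. r (Suc s) x = r s x" "r (Suc s) z = []" "r (Suc s) (Suc z) = [perm q (Suc z)]"
  | (revision) z where "z \<le> m s" "\<forall>k<z. no_alarm_at q (\<alpha> s) (r s) k"
      "\<not> no_alarm_at q (\<alpha> s) (r s) z" "r s z \<noteq> []" "m (Suc s) = z"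
      "\<forall>x<z. r (Suc s) x = r s x" "r (Suc s) z = r s z @ [revise q (last (r s z))]"
proof -
  have "step q (\<alpha> s) (m s, r s) = (m (Suc s), r (Suc s))"
    unfolding m_at_def r_at_def by simp
  from approx_consistent this show thesis
  proof (cases rule: step_cases)
    case advance
    then show thesis by (rule that(1))
  next
    case (discard z)
    then show thesis by (rule that(2))
  next
    case (revision z)
    then show thesis by (rule that(3))
  qed
qed

section \<open>Convergence of the stacks\<close>

lemma bound_Suc:
  assumes "u \<le> Suc (m s)" and "\<forall>y<u. r (Suc s) y = r s y"
  shows "u \<le> m (Suc s)"
proof (cases s rule: stage_cases)
  case (discard z)
  \<comment> \<open>An action at \<open>z < u\<close> would empty or lengthen the stack at
    \<open>z\<close>.\<close>
  then have "\<not> z < u" using assms(2) by auto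
  with discard show ?thesis by simp
next
  case (revision z)
  then have "\<not> z < u" using assms(2) by auto
  with revision show ?thesis by simp
qed (use assms in simp)

text \<open>The stack at \<open>u\<close> is opened only by an advance to \<open>u\<close> or a
  discard at \<open>u - 1\<close>. The hypotheses exclude both, so an empty stack stays
  empty.\<close>

lemma stack_Suc:
  assumes "u \<le> m s" and "\<forall>y<u. r (Suc s) y = r s y"
  obtains "r (Suc s) u = r s u"
  | "r s u \<noteq> []" "r (Suc s) u = []"
  | "r s u \<noteq> []" "r (Suc s) u = r s u @ [revise q (last (r s u))]"
proof (cases s rule: stage_cases)
  case (discard z)
  then have "\<not> z < u" using assms(2) by auto
  with discard that show ?thesis by (cases "z = u") auto
next
  case (revision z)
  then have "\<not> z < u" using assms(2) by auto
  with revision that show ?thesis by (cases "z = u") auto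
qed (use assms that in simp)

text \<open>Every alarm is answered at the least alarming position by emptying or lengthening its
  nonempty stack. Hence an alarm at a fixed position cannot persist once the stacks up to there have
  converged.\<close>

lemma alarm_changes_stack:
  assumes "k \<le> m s" and "\<not> no_alarm_at q (\<alpha> s) (r s) k"
  obtains z where "z \<le> k" and "r (Suc s) z \<noteq> r s z"
proof (cases s rule: stage_cases)
  case (discard z)
  then have "z \<le> k" using assms(2) by (meson not_less)
  with discard show ?thesis by (intro that[of z]) auto
next
  case (revision z)
  then have "z \<le> k" using assms(2) by (meson not_less)
  with revision show ?thesis by (intro that[of z]) auto
qed (use assms in blast)

text \<open>
  Once everything below position \<open>u\<close> has settled, the stack at \<open>u\<close> can only be emptied for good or
  grow; if it grew infinitely often, its tops would run through a whole infinite orbit of \<open>f\<^sup>-\<close>.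
\<close>

lemma stack_settles:
  assumes loopless: "loopless q \<alpha>"
    and below: "\<forall>s\<ge>t. u \<le> m s \<and> (\<forall>y<u. r (Suc s) y = r s y)"
  shows "\<exists>t1\<ge>t. \<forall>s\<ge>t1. r (Suc s) u = r s u"
proof (rule ccontr)
  assume "\<not> ?thesis"
  then have change: "\<exists>s\<ge>t1. r (Suc s) u \<noteq> r s u" if "t1 \<ge> t" for t1
    using that by blast
  \<comment> \<open>Were the stack empty once, it would stay empty and never change again.\<close>
  have nonempty: "r s u \<noteq> []" if "s \<ge> t" for s
  proof
    assume empty: "r s u = []"
    have "r s' u = []" if "s' \<ge> s" for s'
      using that
    proof (induction s' rule: dec_induct)
      case (step n)
      have *: "u \<le> m n" "\<forall>y<u. r (Suc n) y = r n y" using below step \<open>s \<ge> t\<close> by auto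
      show ?case using step.IH by (cases rule: stack_Suc[OF *]) auto
    qed (fact empty)
    then show False using change[OF that] by (metis le_SucI)
  qed
  have grow: "r (Suc s) u = r s u @ [revise q (last (r s u))]"
    if "s \<ge> t" "r (Suc s) u \<noteq> r s u" for s
  proof -
    have *: "u \<le> m s" "\<forall>y<u. r (Suc s) y = r s y" using below that(1) by auto
    show ?thesis using that nonempty[of "Suc s"] by (cases rule: stack_Suc[OF *]) auto
  qed
  have orbit: "\<exists>s\<ge>t. last (r s u) = (revise q ^^ n) (last (r t u))" for n
  proof (induction n)
    case (Suc n)
    then obtain s where s: "s \<ge> t" "last (r s u) = (revise q ^^ n) (last (r t u))" by blast
    \<comment> \<open>The next stage that alters the stack at \<open>u\<close>: until then the top
      is constant, and this stage applies \<open>revise q\<close> to it once.\<close>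
    define s' where "s' = (LEAST s'. s' \<ge> s \<and> r (Suc s') u \<noteq> r s' u)"
    have s': "s' \<ge> s" "r (Suc s') u \<noteq> r s' u"
      using LeastI_ex[of "\<lambda>s'. s' \<ge> s \<and> r (Suc s') u \<noteq> r s' u"] change[OF s(1)]
      unfolding s'_def by auto
    have const: "k \<le> s' \<Longrightarrow> r k u = r s u" if "k \<ge> s" for k
      using that
    proof (induction k rule: dec_induct)
      case (step k)
      then have "r (Suc k) u = r k u"
        using not_less_Least[of k "\<lambda>s'. s' \<ge> s \<and> r (Suc s') u \<noteq> r s' u"]
        unfolding s'_def[symmetric] by auto
      with step show ?case by simp
    qed simp
    have "last (r (Suc s') u) = revise q (last (r s u))"
      using grow[of s'] s(1) s' const[of s'] by simp
    then show ?case using s s'(1) by (intro exI[of _ "Suc s'"]) simp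
  qed auto
  have "range (\<lambda>n. (revise q ^^ n) (last (r t u))) \<subseteq> {last (r s u) | s. r s u \<noteq> []}"
  proof
    fix y assume "y \<in> range (\<lambda>n. (revise q ^^ n) (last (r t u)))"
    then obtain n where "y = (revise q ^^ n) (last (r t u))" by blast
    with orbit[of n] nonempty show "y \<in> {last (r s u) | s. r s u \<noteq> []}" by force
  qed
  moreover have "infinite (range (\<lambda>n. (revise q ^^ n) (last (r t u))))"
    using system unfolding q_dialectical_system_def by blast
  ultimately show False
    using loopless finite_subset unfolding loopless_def by blast
qed

text \<open>The bound is carried through the induction because \<open>stack_settles\<close> needs
  \<open>u\<close> to lie within it: otherwise an advance could open the stack at \<open>u\<close>
  again.\<close>

lemma stacks_settle:
  assumes "loopless q \<alpha>"
  shows "\<exists>t. \<forall>s\<ge>t. u \<le> m s \<and> (\<forall>y<u. r (Suc s) y = r s y)"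
proof (induction u)
  case (Suc u)
  then obtain t where t: "\<forall>s\<ge>t. u \<le> m s \<and> (\<forall>y<u. r (Suc s) y = r s y)" by blast
  from stack_settles[OF assms t] obtain t1
    where t1: "t1 \<ge> t" "\<forall>s\<ge>t1. r (Suc s) u = r s u" by blast
  have stable: "\<forall>y<Suc u. r (Suc s) y = r s y" if "s \<ge> t1" for s
    using t t1 that by (auto simp: less_Suc_eq)
  \<comment> \<open>\<open>bound_Suc\<close> turns \<open>u \<le> m s\<close> into
    \<open>Suc u \<le> m (Suc s)\<close>, so the new bound is only guaranteed one stage after
    \<open>t1\<close>.\<close>
  have bound: "Suc u \<le> m (Suc s)" if "s \<ge> t1" for s
    using bound_Suc[of "Suc u" s] stable[OF that] t t1(1) that by auto
  have "\<forall>s\<ge>Suc t1. Suc u \<le> m s \<and> (\<forall>y<Suc u. r (Suc s) y = r s y)"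
  proof (intro allI impI conjI)
    fix s assume "s \<ge> Suc t1"
    then show "Suc u \<le> m s" using bound[of "s - 1"] by (cases s) auto
  qed (use stable in auto)
  then show ?case by blast
qed simp

lemma limit_stacks:
  assumes "loopless q \<alpha>"
  obtains R where "\<forall>u. eventually (\<lambda>s. u \<le> m s \<and> (\<forall>y<u. r s y = R y)) sequentially"
proof -
  have "\<forall>u. \<exists>t. \<forall>s\<ge>t. r s u = r t u"
  proof
    fix u
    obtain t where "\<forall>s\<ge>t. \<forall>y<Suc u. r (Suc s) y = r s y"
      using stacks_settle[OF assms, of "Suc u"] by blast
    then have t: "r (Suc s) u = r s u" if "s \<ge> t" for s using that by simp
    have "r s u = r t u" if "s \<ge> t" for s
      using that by (induction s rule: dec_induct) (use t in auto)
    then show "\<exists>t. \<forall>s\<ge>t. r s u = r t u" by blast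
  qed
  from choice[OF this] obtain T where T: "\<forall>u. \<forall>s\<ge>T u. r s u = r (T u) u" ..
  have "eventually (\<lambda>s. u \<le> m s \<and> (\<forall>y<u. r s y = r (T y) y)) sequentially" for u
  proof (intro eventually_conj)
    show "eventually (\<lambda>s. u \<le> m s) sequentially"
      using stacks_settle[OF assms, of u] unfolding eventually_sequentially by blast
    have "eventually (\<lambda>s. r s y = r (T y) y) sequentially" for y
      using T unfolding eventually_sequentially by blast
    then have "eventually (\<lambda>s. \<forall>y\<in>{..<u}. r s y = r (T y) y) sequentially"
      by (intro eventually_ball_finite) simp_all
    then show "eventually (\<lambda>s. \<forall>y<u. r s y = r (T y) y) sequentially" by (simp add: lessThan_def Ball_def)
  qed
  then show thesis by (intro that[of "\<lambda>y. r (T y) y"]) blast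
qed

section \<open>Stages with final stacks, and the fate of a single axiom\<close>

text \<open>
  A stage minimising twice the bound, plus one if the last stack counted by \<open>A_at\<close> is nonempty, among
  all later stages: no later action can touch the stacks counted there. The correction is needed
  because discarding at \<open>m s - 1\<close> leaves the bound at \<open>m s\<close>.
\<close>

lemma true_stage:
  obtains s where "s \<ge> t" and "\<And>s' x. s' \<ge> s \<Longrightarrow> x < m s \<Longrightarrow> r s' x = r s x"
proof -
  define \<mu> where "\<mu> s = 2 * m s + (if r s (m s - 1) \<noteq> [] then 1 else 0)" for s
  obtain s where s: "s \<ge> t" and min: "\<And>s'. s' \<ge> t \<Longrightarrow> \<mu> s \<le> \<mu> s'"
    using ex_has_least_nat[of "\<lambda>s. s \<ge> t" t \<mu>] by auto
  \<comment> \<open>The correction is at most 1, so \<open>2 * m s \<le> 2 * m s' + 1\<close>, and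
    parity gives the claim.\<close>
  have m_le: "m s \<le> m s'" if "s' \<ge> s" for s'
    using min[of s'] s that unfolding \<mu>_def by (auto split: if_splits)
  have "\<forall>x<m s. r s' x = r s x" if "s' \<ge> s" for s'
    using that
  proof (induction s' rule: dec_induct)
    case (step n)
    have le: "m s \<le> m (Suc n)" using m_le step.hyps by simp
    show ?case
    proof (cases n rule: stage_cases)
      case advance
      then show ?thesis using step.IH m_le[OF step.hyps(1)] by simp
    next
      case (discard z)
      \<comment> \<open>A discard below \<open>m s\<close> could only hit the last counted stack, at
        \<open>m s - 1\<close>. It would keep the bound but empty a nonempty stack, pushing \<mu>
        below its minimum.\<close>
      have "m s \<le> z"
      proof (rule ccontr)
        assume "\<not> m s \<le> z"
        then have z: "m s = Suc z" using le discard by simp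
        then have "\<mu> (Suc n) = 2 * m s" using discard unfolding \<mu>_def by simp
        moreover have "r s z \<noteq> []" using discard step.IH z by simp
        then have "\<mu> s = 2 * m s + 1" using z unfolding \<mu>_def by simp
        ultimately show False using min[of "Suc n"] s step.hyps by simp
      qed
      then show ?thesis using discard step.IH by simp
    next
      case (revision z)
      then show ?thesis using step.IH le by simp
    qed
  qed simp
  then show thesis using s that by blast
qed

lemma final_set_eq: "final_set q \<alpha> = {y. eventually (\<lambda>s. y \<in> A_at q \<alpha> s) sequentially}"
proof -
  have "surj (perm q)"
    using system bij_is_surj unfolding q_dialectical_system_def by blast
  then show ?thesis
    unfolding final_set_def eventually_sequentially by (auto, metis surjD)
qed

text \<open>The invariant behind completeness. A fresh stack holds only its axiom; it first changes
  when the axiom with the tops below raises an alarm. That consequence is recorded in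
  \<open>H\<close>, so it survives as long as those tops stay. If a lower stack changes and
  \<open>u\<close> remains within the bound, then \<open>u\<close> has just been opened
  afresh.\<close>

lemma axiom_closure_alternatives:
  assumes "u \<le> m s"
  shows "r s u = [perm q u] \<or> contra q \<in> app H (insert (perm q u) (L_set (r s) u))
    \<or> counter q \<in> app H (insert (perm q u) (L_set (r s) u))"
  using assms
proof (induction s arbitrary: u)
  case 0
  then show ?case by (simp add: m_at_def r_at_def start_stacks_def)
next
  case (Suc s)
  show ?case
  proof (cases "u \<le> m s \<and> (\<forall>y<u. r (Suc s) y = r s y)")
    case True
    then have L: "L_set (r (Suc s)) u = L_set (r s) u" by (intro L_set_cong) auto
    show ?thesis
    proof (cases "r (Suc s) u = r s u")
      case True
      then show ?thesis using Suc.IH[of u] L \<open>u \<le> m s \<and> _\<close> by simp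
    next
      case changed: False
      \<comment> \<open>Only an action at \<open>u\<close> itself fits: the stacks below are
        unchanged, and an action above leaves \<open>u\<close> alone.\<close>
      have alarm: "\<not> no_alarm_at q (\<alpha> s) (r s) u"
      proof (cases s rule: stage_cases)
        case advance
        then show ?thesis using changed True by simp
      next
        case (discard z)
        then have "\<not> z < u" "\<not> u < z" using changed True by auto
        then have "z = u" by simp
        then show ?thesis using discard by simp
      next
        case (revision z)
        then have "\<not> z < u" "\<not> u < z" using changed True by auto
        then have "z = u" by simp
        then show ?thesis using revision by simp
      qed
      then have "{contra q, counter q} \<inter> app H (L_set (r s) (Suc u)) \<noteq> {}"
        using app_mono[OF approx_subset[of s] subset_refl[of "L_set (r s) (Suc u)"]]
        unfolding no_alarm_at_def chi_def by auto
      \<comment> \<open>If the stack at \<open>u\<close> was still \<open>[perm q u]\<close>, the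
        alarm concerns exactly the axiom and the tops below; otherwise an alternative held
        already.\<close>
      then show ?thesis using Suc.IH[of u] True L by (auto simp: L_set_Suc)
    qed
  next
    case False
    show ?thesis
    proof (cases s rule: stage_cases)
      case advance
      then have "u = Suc (m s)" using False Suc.prems by (auto simp: le_Suc_eq)
      then show ?thesis using advance by simp
    next
      case (discard z)
      then have "u = Suc z" using False Suc.prems by (auto simp: le_Suc_eq)
      then show ?thesis using discard by simp
    next
      case (revision z)
      then show ?thesis using False Suc.prems by simp
    qed
  qed
qed

end

section \<open>The limit stacks and the closure of their tops\<close>

text \<open>\<open>R\<close> is the pointwise limit of the stacks.\<close>

locale settled_run = q_run +
  fixes R
  assumes settled: "\<And>u. eventually (\<lambda>s. u \<le> m s \<and> (\<forall>y<u. r s y = R y)) sequentially"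
begin

definition tops :: "nat set" where
  "tops = (\<Union>u. L_set R u)"

lemma settled_L_set:
  "eventually (\<lambda>s. u \<le> m s \<and> L_set (r s) u = L_set R u) sequentially"
  using settled[of u]
proof eventually_elim
  case (elim s)
  then show ?case using L_set_cong[of u "r s" R] by simp
qed

text \<open>Compactness: one pair of \<open>H\<close> witnesses membership, its finite set lies
  among the tops below some \<open>u\<close>, and eventually the pair is enumerated and these tops
  are in place. A fixed \<open>u < m s\<close> serves both for alarms and for
  \<open>A_at\<close>.\<close>

lemma in_closure_tops:
  assumes "y \<in> app H tops"
  obtains u where "eventually (\<lambda>s. u < m s \<and> y \<in> chi (\<alpha> s) (r s) u) sequentially"
proof -
  obtain D where D: "finite D" "D \<subseteq> tops" "(y, D) \<in> H"
    using assms unfolding app_def by blast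
  obtain u where u: "D \<subseteq> L_set R u"
    using finite_subset_L_set[OF D(1)] D(2) unfolding tops_def by blast
  have "eventually (\<lambda>s. u < m s \<and> y \<in> chi (\<alpha> s) (r s) u) sequentially"
    using approx_eventually[OF D(3)] settled_L_set[of "Suc u"]
  proof eventually_elim
    case (elim s)
    have "D \<subseteq> L_set (r s) (Suc u)" using elim u L_set_mono[of u "Suc u" R] by simp
    then show ?case using elim D(1) unfolding chi_def app_def by auto
  qed
  then show thesis by (rule that)
qed

text \<open>A permanent alarm at a fixed \<open>u\<close> would alter some stack in
  \<open>{..u}\<close> at every late stage, against convergence.\<close>

lemma closure_tops_consistent: "{contra q, counter q} \<inter> app H tops = {}"
proof (rule ccontr)
  assume "{contra q, counter q} \<inter> app H tops \<noteq> {}"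
  then obtain y where y: "y \<in> {contra q, counter q}" "y \<in> app H tops" by blast
  obtain u where u: "eventually (\<lambda>s. u < m s \<and> y \<in> chi (\<alpha> s) (r s) u) sequentially"
    using in_closure_tops[OF y(2)] .
  have "eventually (\<lambda>s. r s y = r (Suc s) y) sequentially" for y
  proof -
    have "eventually (\<lambda>s. r s y = R y) sequentially"
      using settled[of "Suc y"] by eventually_elim simp
    moreover from this have "eventually (\<lambda>s. r (Suc s) y = R y) sequentially"
      unfolding eventually_sequentially by (meson le_SucI)
    ultimately show ?thesis by eventually_elim simp
  qed
  then have "eventually (\<lambda>s. \<forall>z\<in>{..u}. r s z = r (Suc s) z) sequentially"
    by (intro eventually_ball_finite) auto
  with u have "eventually (\<lambda>s. False) sequentially"
  proof eventually_elim
    case (elim s)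
    then have "\<not> no_alarm_at q (\<alpha> s) (r s) u" using y(1) unfolding no_alarm_at_def by auto
    then show ?case using alarm_changes_stack[of u s] elim by (metis atMost_iff less_imp_le)
  qed
  then show False by simp
qed

lemma final_set_eq_closure: "final_set q \<alpha> = app H tops"
proof (intro equalityI subsetI)
  fix y assume "y \<in> final_set q \<alpha>"
  then obtain t where t: "\<And>s. s \<ge> t \<Longrightarrow> y \<in> A_at q \<alpha> s"
    unfolding final_set_eq eventually_sequentially by blast
  \<comment> \<open>Membership in each \<open>A_at\<close> could rest on tops that are later
    withdrawn. At a stage whose counted stacks are final, the tops used are limit tops.\<close>
  obtain s where s: "s \<ge> t" "\<And>s' x. s' \<ge> s \<Longrightarrow> x < m s \<Longrightarrow> r s' x = r s x"
    using true_stage[of t] by blast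
  obtain i where i: "i < m s" "y \<in> app (\<alpha> s) (L_set (r s) (Suc i))"
    using t[OF s(1)] unfolding A_at_def chi_def by auto
  obtain t' where t': "\<And>s'. s' \<ge> t' \<Longrightarrow> L_set (r s') (Suc i) = L_set R (Suc i)"
    using settled_L_set[of "Suc i"] unfolding eventually_sequentially by blast
  have "L_set (r s) (Suc i) = L_set (r (max s t')) (Suc i)"
    using s(2)[of "max s t'"] i(1) by (intro L_set_cong) simp
  also have "\<dots> = L_set R (Suc i)" using t' by simp
  finally have "L_set (r s) (Suc i) \<subseteq> tops" unfolding tops_def by blast
  then show "y \<in> app H tops" using i(2) app_mono[OF approx_subset] by blast
next
  fix y assume "y \<in> app H tops"
  from in_closure_tops[OF this] obtain u
    where u: "eventually (\<lambda>s. u < m s \<and> y \<in> chi (\<alpha> s) (r s) u) sequentially" .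
  then have "eventually (\<lambda>s. y \<in> A_at q \<alpha> s) sequentially"
    by eventually_elim (auto simp: A_at_def)
  then show "y \<in> final_set q \<alpha>" unfolding final_set_eq by simp
qed

section \<open>Completeness\<close>

lemma closure_tops_alternatives:
  "y \<in> app H tops \<or> contra q \<in> app H (insert y tops) \<or> counter q \<in> app H (insert y tops)"
proof -
  have "surj (perm q)"
    using system bij_is_surj unfolding q_dialectical_system_def by blast
  then obtain u where u: "y = perm q u" by (rule surjE)
  \<comment> \<open>Once the stacks up to \<open>u\<close> have their final form, the invariant for
    the axiom at \<open>u\<close> transfers to \<open>tops\<close>.\<close>
  obtain s where s: "Suc u \<le> m s" "\<forall>x<Suc u. r s x = R x"
    using eventually_happens[OF settled[of "Suc u"]] by auto
  have "L_set (r s) v = L_set R v" if "v \<le> Suc u" for v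
    using s(2) that by (intro L_set_cong) auto
  then have L: "L_set (r s) v \<subseteq> tops" if "v \<le> Suc u" for v
    using that unfolding tops_def by auto
  have sub: "app H (insert y (L_set (r s) u)) \<subseteq> app H (insert y tops)"
    using L[of u] by (intro app_mono) auto
  have "r s u = [perm q u] \<Longrightarrow> y \<in> tops"
    using L[of "Suc u"] u by (auto simp: L_set_Suc)
  then have "r s u = [perm q u] \<Longrightarrow> y \<in> app H tops"
    using closure unfolding algebraic_closure_operator_def by blast
  then show ?thesis using axiom_closure_alternatives[of u s] s(1) sub u by auto
qed

lemma closure_tops_completion:
  assumes "connectives q neg imp con dis"
  shows "completion neg (app H tops)"
proof -
  have contra_pair: "contra q \<in> app H {x, neg x}"
    and double_neg: "app H {neg (neg x)} = app H {x}"
    and excluded_middle: "dis x (neg x) \<in> app H {}"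
    and dis: "app H (X \<union> {dis x y}) = app H (X \<union> {x}) \<inter> app H (X \<union> {y})"
    and neg_intro: "contra q \<in> app H (X \<union> {x}) \<Longrightarrow> neg x \<in> app H X" for X x y
    using assms unfolding connectives_def Let_def by blast+
  have incl: "X \<subseteq> app H X" for X
    using closure unfolding algebraic_closure_operator_def by blast
  have not_both: "\<not> (x \<in> app H tops \<and> neg x \<in> app H tops)" for x
    using contra_pair[of x] app_closed[OF closure, of "{x, neg x}" tops] closure_tops_consistent
    by blast
  have "x \<in> app H tops \<or> neg x \<in> app H tops" for x
  proof (rule ccontr)
    assume neither: "\<not> ?thesis"
    have "contra q \<notin> app H (insert x tops)"
      using neg_intro[of tops x] neither by auto
    then have 1: "counter q \<in> app H (insert x tops)"
      using closure_tops_alternatives[of x] neither by blast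
    have "contra q \<notin> app H (insert (neg x) tops)"
    proof
      assume "contra q \<in> app H (insert (neg x) tops)"
      \<comment> \<open>Negation introduction yields only \<open>neg (neg x)\<close>; its closure
        equals that of \<open>x\<close>, which brings back \<open>x\<close>.\<close>
      then have "neg (neg x) \<in> app H tops" using neg_intro[of tops "neg x"] by simp
      then have "app H {x} \<subseteq> app H tops"
        using app_closed[OF closure, of "{neg (neg x)}" tops] double_neg by simp
      then show False using incl[of "{x}"] neither by blast
    qed
    then have 2: "counter q \<in> app H (insert (neg x) tops)"
      using closure_tops_alternatives[of "neg x"] neither by blast
    have "dis x (neg x) \<in> app H tops"
      using excluded_middle[of x] app_mono[OF subset_refl empty_subsetI] by (rule rev_subsetD)
    \<comment> \<open>Excluded middle is already derived, so adding it changes nothing, and the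
      disjunction law splits the closure of \<open>tops\<close> into the two cases.\<close>
    from app_insert_absorb[OF closure this]
    have "app H tops = app H (insert x tops) \<inter> app H (insert (neg x) tops)"
      using dis[of tops x "neg x"] by simp
    then show False using 1 2 closure_tops_consistent by blast
  qed
  with not_both show ?thesis unfolding completion_def by blast
qed

end

theorem theorem4p3:
  fixes q :: q_system
    and \<alpha> :: "nat \<Rightarrow> (nat \<times> nat set) set"
    and neg :: "nat \<Rightarrow> nat"
    and imp con dis :: "nat \<Rightarrow> nat \<Rightarrow> nat"
  assumes "q_dialectical_system q"
    and "consistent q"
    and "connectives q neg imp con dis"
    and "computable_approximation (oper q) \<alpha>"
    and "loopless q \<alpha>"
  shows "completion neg (final_set q \<alpha>)"
proof -
  interpret q_run q \<alpha> using assms by unfold_locales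
  obtain R where "\<forall>u. eventually (\<lambda>s. u \<le> m s \<and> (\<forall>y<u. r s y = R y)) sequentially"
    using limit_stacks[OF assms(5)] .
  then interpret settled_run q \<alpha> R by unfold_locales blast
  show ?thesis
    using closure_tops_completion[OF assms(3)] by (simp add: final_set_eq_closure)
qed

end
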